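(* Let $\{\mathsf{P}_\theta : \theta \in \mathbb{T}\}$ be a statistical model for data $Z$ taking values in a sample space $\mathbb{Z}$, where each $\mathsf{P}_\theta$ has a density/mass function $p_\theta$ with respect to a common dominating measure, and assume that $\sup_{\vartheta \in \mathbb{T}} p_\vartheta(z)$ is finite for almost all $z$. Let $$R(z,\theta) = \frac{p_\theta(z)}{\sup_{\vartheta \in \mathbb{T}} p_\vartheta(z)}, \qquad \pi_z(\theta) = \mathsf{P}_\theta\bigl\{ R(Z,\theta) \leq R(z,\theta) \bigr\}, \qquad \theta \in \mathbb{T},\ z \in \mathbb{Z},$$ and define, for $H \subseteq \mathbb{T}$, the upper and lower probabilities of the possibilistic inferential model $$\overline{\Pi}_z(H) = \sup_{\theta \in H} \pi_z(\theta), \qquad \underline{\Pi}_z(H) = 1 - \overline{\Pi}_z(H^c).$$ Then the possibilistic inferential model is valid in the sense that $$\sup_{\theta \in H} \mathsf{P}_\theta\bigl\{ \overline{\Pi}_Z(H) \leq \alpha \bigr\} \leq \alpha \quad \text{for all } \alpha \in [0,1] \text{ and all } H \subseteq \mathbb{T}.$$ Consequently: (i) for every hypothesis $H \subseteq \mathbb{T}$, the test that rejects "$\Theta \in H$" (where $\Theta$ is the true parameter value) if and only if $\overline{\Pi}_z(H) \leq \alpha$ controls the Type I error probability at level $\alpha$, i.e., for every $\theta \in H$ the $\mathsf{P}_\theta$-probability that it rejects is at most $\alpha$; (ii) the false confidence rate associated with $z \mapsto \underline{\Pi}_z$, namely $$\mathrm{fcr}_{\underline{\Pi}}(\alpha,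 H) = \sup_{\theta \notin H} \mathsf{P}_\theta\bigl\{ \underline{\Pi}_Z(H) > 1-\alpha \bigr\}, \qquad \alpha \in (0,1),\ H \subset \mathbb{T},$$ satisfies $\mathrm{fcr}_{\underline{\Pi}}(\alpha, H) \leq \alpha$ for all $\alpha \in (0,1)$ and all $H \subset \mathbb{T}$.
   Context: In $\mathsf{P}_\theta\{\cdots\}$ the random variable is $Z \sim \mathsf{P}_\theta$; in the definition of $\pi_z(\theta)$ the value $z$ is fixed. $H^c = \mathbb{T} \setminus H$. Suprema of $[0,1]$-valued quantities over the empty set are taken to be $0$. It is assumed that $z \mapsto R(z,\theta)$ is measurable for each $\theta$; if an event such as $\{\overline{\Pi}_Z(H) \leq \alpha\}$ is not measurable, its probability is understood as outer probability. The ratio $R(z,\theta)$ may be assigned an arbitrary fixed value, e.g. $0$, at points $z$ where $\sup_\vartheta p_\vartheta(z) \in \{0,\infty\}$ (such $z$ form a $\mathsf{P}_\theta$-null set for every $\theta$). *)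

theory Defs
  imports "HOL-Probability.Probability"
begin

(* On the type real the library's Sup of the empty set is unspecified; here it is 0. *)
definition sup0 :: "('a \<Rightarrow> real) \<Rightarrow> 'a set \<Rightarrow> real" where
  "sup0 f A = (if A = {} then 0 else (SUP x\<in>A. f x))"

definition outer_prob :: "'z measure \<Rightarrow> 'z set \<Rightarrow> real" where
  "outer_prob M A = enn2real (outer_measure_of M A)"

lemma outer_prob_eq_measure: "A \<in> sets M \<Longrightarrow> outer_prob M A = measure M A"
  by (simp add: outer_prob_def measure_def)

(* nu is the dominating measure, T the parameter space, P the family of distributions
   and p the family of their densities with respect to nu. *)
definition dominated_model ::
    "'z measure \<Rightarrow> 't set \<Rightarrow> ('t \<Rightarrow> 'z measure) \<Rightarrow> ('t \<Rightarrow> 'z \<Rightarrow> ennreal) \<Rightarrow> bool" where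
  "dominated_model \<nu> T P p \<longleftrightarrow>
     (\<forall>\<theta>\<in>T. p \<theta> \<in> borel_measurable \<nu> \<and> P \<theta> = density \<nu> (p \<theta>) \<and> prob_space (P \<theta>))"

definition sup_lik :: "'t set \<Rightarrow> ('t \<Rightarrow> 'z \<Rightarrow> ennreal) \<Rightarrow> 'z \<Rightarrow> ennreal" where
  "sup_lik T p z = (SUP \<theta>\<in>T. p \<theta> z)"

(* c is the arbitrary value given to the ratio at the points where it is undefined. *)
definition rel_lik ::
    "'t set \<Rightarrow> ('t \<Rightarrow> 'z \<Rightarrow> ennreal) \<Rightarrow> real \<Rightarrow> 'z \<Rightarrow> 't \<Rightarrow> real" where
  "rel_lik T p c z \<theta> =
     (if sup_lik T p z \<in> {0, \<infinity>} then c else enn2real (p \<theta> z / sup_lik T p z))"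

definition contour ::
    "'t set \<Rightarrow> ('t \<Rightarrow> 'z measure) \<Rightarrow> ('t \<Rightarrow> 'z \<Rightarrow> ennreal) \<Rightarrow> real \<Rightarrow> 'z \<Rightarrow> 't \<Rightarrow> real" where
  "contour T P p c z \<theta> =
     measure (P \<theta>) {w \<in> space (P \<theta>). rel_lik T p c w \<theta> \<le> rel_lik T p c z \<theta>}"

definition upper_prob ::
    "'t set \<Rightarrow> ('t \<Rightarrow> 'z measure) \<Rightarrow> ('t \<Rightarrow> 'z \<Rightarrow> ennreal) \<Rightarrow> real \<Rightarrow> 'z \<Rightarrow> 't set \<Rightarrow> real" where
  "upper_prob T P p c z H = sup0 (contour T P p c z) H"

definition lower_prob ::
    "'t set \<Rightarrow> ('t \<Rightarrow> 'z measure) \<Rightarrow> ('t \<Rightarrow> 'z \<Rightarrow> ennreal) \<Rightarrow> real \<Rightarrow> 'z \<Rightarrow> 't set \<Rightarrow> real" where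
  "lower_prob T P p c z H = 1 - upper_prob T P p c z (T - H)"

definition rejects ::
    "'t set \<Rightarrow> ('t \<Rightarrow> 'z measure) \<Rightarrow> ('t \<Rightarrow> 'z \<Rightarrow> ennreal) \<Rightarrow> real \<Rightarrow> real \<Rightarrow> 't set \<Rightarrow> 'z \<Rightarrow> bool" where
  "rejects T P p c \<alpha> H z \<longleftrightarrow> upper_prob T P p c z H \<le> \<alpha>"

(* false confidence rate of a data-dependent lower probability L *)
definition fcr ::
    "'t set \<Rightarrow> ('t \<Rightarrow> 'z measure) \<Rightarrow> ('z \<Rightarrow> 't set \<Rightarrow> real) \<Rightarrow> real \<Rightarrow> 't set \<Rightarrow> real" where
  "fcr T P L \<alpha> H =
     sup0 (\<lambda>\<theta>. outer_prob (P \<theta>) {z \<in> space (P \<theta>). L z H > 1 - \<alpha>}) (T - H)"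

end

theory Submission
  imports Defs
begin

text \<open>For a fixed parameter, the contour evaluated at the data is the distribution function of the
  relative likelihood evaluated at the relative likelihood itself, hence stochastically no smaller
  than a uniform variable. The upper probability of a hypothesis dominates the contour at each of
  its points, so under a true parameter in the hypothesis it is no smaller than such a variable.\<close>

text \<open>As \<open>cdf M\<close> is nondecreasing, the set is closed downwards: it is empty, the
  whole line, or a ray that contains its supremum or omits it. Each shape ties its measure to a
  value or limit of the cdf. Atoms are allowed.\<close>

lemma (in real_distribution) measure_cdf_le:
  assumes "0 \<le> \<alpha>"
  shows "measure M {x. cdf M x \<le> \<alpha>} \<le> \<alpha>"
proof -
  define S where "S = {x. cdf M x \<le> \<alpha>}"
  have down: "x \<in> S" if "y \<in> S" "x \<le> y" for x y
    using that cdf_nondecreasing[of x y] by (auto simp: S_def)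
  consider "S = {}" | "S \<noteq> {}" "\<not> bdd_above S" | "S \<noteq> {}" "bdd_above S" "Sup S \<in> S"
    | "S \<noteq> {}" "bdd_above S" "Sup S \<notin> S"
    by argo
  then have "measure M S \<le> \<alpha>"
  proof cases
    case 1
    then show ?thesis using assms by simp
  next
    case 2
    then have "x \<in> S" for x
      using down[of _ x] by (meson bdd_aboveI linorder_le_cases)
    \<comment> \<open>Here the cdf is at most \<alpha> everywhere, and so is its limit 1 at
      infinity.\<close>
    then have "1 \<le> \<alpha>"
      using tendsto_upperbound[OF cdf_lim_at_top_prob, of \<alpha>] by (auto simp: S_def)
    then show ?thesis
      using prob_le_1 order_trans by blast
  next
    case 3
    then have "S = {..Sup S}"
      by (auto intro: down cSup_upper)
    then have "measure M S = cdf M (Sup S)"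
      unfolding cdf_def by (rule arg_cong)
    then show ?thesis
      using 3 by (simp add: S_def)
  next
    case 4
    have less: "x \<in> S" if "x < Sup S" for x
      using less_cSupD[OF \<open>S \<noteq> {}\<close> that] down less_imp_le by blast
    have "x < Sup S" if "x \<in> S" for x
      using 4 that cSup_upper[of x S] by (cases "x = Sup S") auto
    with less have "S = {..<Sup S}"
      by blast
    \<comment> \<open>The cdf may jump above \<alpha> at \<open>Sup S\<close>; the open ray has the
      left limit as its measure, which inherits the bound from the points below.\<close>
    moreover have "measure M {..<Sup S} \<le> \<alpha>"
    proof (rule tendsto_upperbound[OF cdf_at_left])
      show "\<forall>\<^sub>F x in at_left (Sup S). cdf M x \<le> \<alpha>"
        using less by (auto simp: eventually_at_filter S_def)
    qed simp
    ultimately show ?thesis by simp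
  qed
  then show ?thesis by (simp add: S_def)
qed

text \<open>The event is the preimage under \<open>X\<close> of a sublevel set of the cdf of
  \<open>X\<close>, so the bound carries over from the distribution of \<open>X\<close>.\<close>

lemma (in prob_space) prob_distribution_function_le:
  fixes X :: "'a \<Rightarrow> real"
  assumes X [measurable]: "random_variable borel X" and "0 \<le> \<alpha>"
  defines "A \<equiv> {z \<in> space M. prob {w \<in> space M. X w \<le> X z} \<le> \<alpha>}"
  shows "A \<in> events" and "prob A \<le> \<alpha>"
proof -
  interpret D: real_distribution "distr M borel X"
    by (rule real_distribution_distr) fact
  have F: "prob {w \<in> space M. X w \<le> x} = cdf (distr M borel X) x" for x
    by (simp add: cdf_def measure_distr vimage_def Int_def conj_commute)
  have [measurable]: "cdf (distr M borel X) \<in> borel_measurable borel"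
    by (intro borel_measurable_mono monoI D.cdf_nondecreasing)
  have A: "A = X -` {x. cdf (distr M borel X) x \<le> \<alpha>} \<inter> space M"
    by (auto simp: A_def F)
  show "A \<in> events"
    unfolding A by measurable
  show "prob A \<le> \<alpha>"
    using D.measure_cdf_le[OF \<open>0 \<le> \<alpha>\<close>] by (simp add: A measure_distr)
qed

text \<open>Finiteness of \<open>B\<close> matters because \<open>enn2real\<close> sends infinity to
  0 and is monotone only below a finite bound.\<close>

lemma outer_prob_le_measure:
  assumes "A \<subseteq> B" "B \<in> fmeasurable M"
  shows "outer_prob M A \<le> measure M B"
proof -
  have "outer_measure_of M A \<le> emeasure M B"
    using outer_measure_of_mono[OF \<open>A \<subseteq> B\<close>, of M] assms(2) by (simp add: fmeasurableD)
  then show ?thesis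
    using assms(2) by (auto simp: outer_prob_def measure_def fmeasurable_def intro: enn2real_mono)
qed

lemma sup0_le:
  assumes "0 \<le> b" "\<And>x. x \<in> A \<Longrightarrow> f x \<le> b"
  shows "sup0 f A \<le> b"
  using assms by (auto simp: sup0_def intro: cSUP_least)

lemma sup0_upper:
  assumes "bdd_above (f ` A)" "x \<in> A"
  shows "f x \<le> sup0 f A"
  using assms by (auto simp: sup0_def intro: cSUP_upper)

text \<open>Contour values are probabilities, so 1 bounds them and the real supremum is a genuine
  upper bound.\<close>

lemma contour_le_upper_prob:
  assumes "dominated_model \<nu> T P p" "H \<subseteq> T" "\<theta> \<in> H"
  shows "contour T P p c z \<theta> \<le> upper_prob T P p c z H"
proof -
  have "bdd_above (contour T P p c z ` H)"
    using assms(1,2)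
    by (auto simp: contour_def dominated_model_def intro!: bdd_aboveI[of _ 1] prob_space.prob_le_1)
  then show ?thesis
    using assms(3) by (simp add: upper_prob_def sup0_upper)
qed

text \<open>The set \<open>A\<close> is left general, possibly nonmeasurable, to serve all three
  claims; it is enclosed in a measurable event about the contour at \<theta> alone.\<close>

lemma outer_prob_upper_prob_le:
  assumes model: "dominated_model \<nu> T P p"
    and meas: "(\<lambda>z. rel_lik T p c z \<theta>) \<in> borel_measurable \<nu>"
    and "H \<subseteq> T" "\<theta> \<in> H" "0 \<le> \<alpha>"
    and A: "\<And>z. z \<in> A \<Longrightarrow> z \<in> space (P \<theta>) \<and> upper_prob T P p c z H \<le> \<alpha>"
  shows "outer_prob (P \<theta>) A \<le> \<alpha>"
proof -
  have "P \<theta> = density \<nu> (p \<theta>)" and prob: "prob_space (P \<theta>)"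
    using assms by (auto simp: dominated_model_def)
  then have meas': "(\<lambda>z. rel_lik T p c z \<theta>) \<in> borel_measurable (P \<theta>)"
    using meas by simp
  interpret prob_space "P \<theta>" by fact
  define B where "B = {z \<in> space (P \<theta>). contour T P p c z \<theta> \<le> \<alpha>}"
  have "A \<subseteq> B"
    using A contour_le_upper_prob[OF model \<open>H \<subseteq> T\<close> \<open>\<theta> \<in> H\<close>] order_trans
    unfolding B_def by blast
  moreover have "B \<in> events" "prob B \<le> \<alpha>"
    using prob_distribution_function_le[OF meas' \<open>0 \<le> \<alpha>\<close>] by (simp_all add: B_def contour_def)
  ultimately show ?thesis
    using outer_prob_le_measure[of A B "P \<theta>"] by (simp add: fmeasurable_eq_sets)
qed

theorem corollary2:
  fixes \<nu> :: "'z measure"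
    and T :: "'t set"
    and P :: "'t \<Rightarrow> 'z measure"
    and p :: "'t \<Rightarrow> 'z \<Rightarrow> ennreal"
    and c :: real
  assumes model: "dominated_model \<nu> T P p"
    and sup_finite: "AE z in \<nu>. sup_lik T p z < \<infinity>"
    and ratio_measurable: "\<And>\<theta>. \<theta> \<in> T \<Longrightarrow> (\<lambda>z. rel_lik T p c z \<theta>) \<in> borel_measurable \<nu>"
  shows "(\<forall>\<alpha>\<in>{0..1}. \<forall>H\<subseteq>T.
            sup0 (\<lambda>\<theta>. outer_prob (P \<theta>) {z \<in> space (P \<theta>). upper_prob T P p c z H \<le> \<alpha>}) H \<le> \<alpha>) \<and>
         (\<forall>H\<subseteq>T. \<forall>\<alpha>\<in>{0..1}. \<forall>\<theta>\<in>H.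
            outer_prob (P \<theta>) {z \<in> space (P \<theta>). rejects T P p c \<alpha> H z} \<le> \<alpha>) \<and>
         (\<forall>\<alpha>\<in>{0<..<1}. \<forall>H\<subseteq>T. fcr T P (lower_prob T P p c) \<alpha> H \<le> \<alpha>)"
proof (intro conjI ballI allI impI)
  note bound = outer_prob_upper_prob_le[OF model ratio_measurable]
  show "sup0 (\<lambda>\<theta>. outer_prob (P \<theta>) {z \<in> space (P \<theta>). upper_prob T P p c z H \<le> \<alpha>}) H \<le> \<alpha>"
    if "\<alpha> \<in> {0..1}" "H \<subseteq> T" for \<alpha> H
    using that by (intro sup0_le bound[of _ H]) auto
  show "outer_prob (P \<theta>) {z \<in> space (P \<theta>). rejects T P p c \<alpha> H z} \<le> \<alpha>"
    if "H \<subseteq> T" "\<alpha> \<in> {0..1}" "\<theta> \<in> H" for H \<alpha> \<theta>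
    using that by (intro bound[of _ H]) (auto simp: rejects_def)
  show "fcr T P (lower_prob T P p c) \<alpha> H \<le> \<alpha>"
    if "\<alpha> \<in> {0<..<1}" "H \<subseteq> T" for \<alpha> H
    \<comment> \<open>A lower probability of \<open>H\<close> above 1 - \<alpha> means an upper
      probability of \<open>T - H\<close> below \<alpha>, and the true parameter lies in
      \<open>T - H\<close>.\<close>
    unfolding fcr_def using that
    by (intro sup0_le bound[of _ "T - H"]) (auto simp: lower_prob_def)
qed

end
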